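(* Let $L$ be a first-order language and suppose there exist formulas $\alpha(\vec v),\beta(\vec v)$ of $L$ and tuples $\vec t,\vec s$ of closed terms such that: (a) $\alpha(\vec s)$ and $\beta(\vec t)$ are the same formula; (b) $\alpha(\vec t)$ and $\beta(\vec s)$ are the same formula; (c) both $\alpha(\vec t)\wedge\neg\beta(\vec t)$ and $\neg\alpha(\vec t)\wedge\beta(\vec t)$ are satisfiable. Then for every choice function $f$ for $Fml(L)$ there exist an $L$-structure $\mathcal M$, a formula $\psi(\vec v)$ of $L_s$ and a tuple $\vec r$ of closed terms such that $\langle\mathcal M,f\rangle\models^1_s\forall\vec v\,\psi(\vec v)\wedge\neg\psi(\vec r)$.
   Context: $L$ is a first-order language with logical symbols $\wedge,\neg,\forall$ and equality; the other connectives and $\exists=\neg\forall\neg$ are abbreviations. $L_s=L\cup\{|\}$, where $|$ is a new binary connective; $Fml(L_s)$ is the set of all formulas built by the usual recursion together with the clause that $\varphi|\psi$ is a formula whenever $\varphi,\psi$ are. $Fml(L)$ is the set of formulas of $L$. A choice function for $Fml(L)$ is a map $f$ assigning to each unordered pair $\{\alpha,\beta\}$ of formulas of $L$ (singletons included) an element $f(\alpha,\beta)\in\{\alpha,\beta\}$; thus $f(\alpha,\beta)=f(\beta,\alpha)$ and $f(\alpha,\alpha)=\alpha$. Its collapsing map $\overline f:Fml(L_s)\to Fml(L)$ is defined recursively by $\overline f(\alpha)=\alpha$ for $\alpha\in Fml(L)$, $\overline f(\varphi\wedge\psi)=\overline f(\varphi)\wedge\overline f(\psi)$, $\overline f(\neg\varphi)=\neg\overline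 f(\varphi)$, $\overline f(\forall v\varphi)=\forall v\,\overline f(\varphi)$, $\overline f(\varphi|\psi)=f(\overline f(\varphi),\overline f(\psi))$. For an $L$-structure $\mathcal M$ and a sentence $\varphi$ of $L_s$, $\langle\mathcal M,f\rangle\models^1_s\varphi$ iff $\mathcal M\models\overline f(\varphi)$. $\alpha(\vec t)$ denotes simultaneous substitution of the terms $\vec t$ for the variables $\vec v$. *)

theory Defs
  imports Main
begin

text \<open>
  Symbols are drawn from arbitrary sets inside the types \<open>'f\<close> and \<open>'p\<close>, so that a language
  may have no function symbols or no relation symbols. Constants are 0-ary function symbols.
\<close>

record ('f, 'p) language =
  fun_syms :: "'f set"
  rel_syms :: "'p set"
  fun_arity :: "'f \<Rightarrow> nat"
  rel_arity :: "'p \<Rightarrow> nat"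

type_synonym var = nat

datatype 'f tm = Var var | Fn 'f "'f tm list"

text \<open>
  Formulas have named variables, so equality of type \<open>fm\<close> is literal identity of formulas, not
  identity up to renaming of bound variables. The type contains the raw formulas with the
  connective \<open>|\<close> (constructor \<open>Choice\<close>); the formulas of \<open>L\<close> are among those of \<open>L\<^sub>s\<close>.
\<close>

datatype ('f, 'p) fm =
    Eq "'f tm" "'f tm"
  | Rel 'p "'f tm list"
  | And "('f, 'p) fm" "('f, 'p) fm"
  | Neg "('f, 'p) fm"
  | Forall var "('f, 'p) fm"
  | Choice "('f, 'p) fm" "('f, 'p) fm"

fun is_tm :: "('f, 'p) language \<Rightarrow> 'f tm \<Rightarrow> bool" where
  "is_tm L (Var x) = True"
| "is_tm L (Fn F ts) = (F \<in> fun_syms L \<and> length ts = fun_arity L F \<and> (\<forall>t \<in> set ts. is_tm L t))"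

inductive_set Fml_s :: "('f, 'p) language \<Rightarrow> ('f, 'p) fm set" for L where
  "is_tm L t \<Longrightarrow> is_tm L u \<Longrightarrow> Eq t u \<in> Fml_s L"
| "P \<in> rel_syms L \<Longrightarrow> length ts = rel_arity L P \<Longrightarrow> \<forall>t \<in> set ts. is_tm L t \<Longrightarrow> Rel P ts \<in> Fml_s L"
| "\<phi> \<in> Fml_s L \<Longrightarrow> \<psi> \<in> Fml_s L \<Longrightarrow> And \<phi> \<psi> \<in> Fml_s L"
| "\<phi> \<in> Fml_s L \<Longrightarrow> Neg \<phi> \<in> Fml_s L"
| "\<phi> \<in> Fml_s L \<Longrightarrow> Forall x \<phi> \<in> Fml_s L"
| "\<phi> \<in> Fml_s L \<Longrightarrow> \<psi> \<in> Fml_s L \<Longrightarrow> Choice \<phi> \<psi> \<in> Fml_s L"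

inductive_set Fml :: "('f, 'p) language \<Rightarrow> ('f, 'p) fm set" for L where
  "is_tm L t \<Longrightarrow> is_tm L u \<Longrightarrow> Eq t u \<in> Fml L"
| "P \<in> rel_syms L \<Longrightarrow> length ts = rel_arity L P \<Longrightarrow> \<forall>t \<in> set ts. is_tm L t \<Longrightarrow> Rel P ts \<in> Fml L"
| "\<phi> \<in> Fml L \<Longrightarrow> \<psi> \<in> Fml L \<Longrightarrow> And \<phi> \<psi> \<in> Fml L"
| "\<phi> \<in> Fml L \<Longrightarrow> Neg \<phi> \<in> Fml L"
| "\<phi> \<in> Fml L \<Longrightarrow> Forall x \<phi> \<in> Fml L"

lemma Fml_subset_Fml_s: "Fml L \<subseteq> Fml_s L"
proof
  fix \<phi> assume "\<phi> \<in> Fml L"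
  then show "\<phi> \<in> Fml_s L" by induction (auto intro: Fml_s.intros)
qed

fun vars_tm :: "'f tm \<Rightarrow> var set" where
  "vars_tm (Var x) = {x}"
| "vars_tm (Fn F ts) = (\<Union>t \<in> set ts. vars_tm t)"

definition closed_tm :: "('f, 'p) language \<Rightarrow> 'f tm \<Rightarrow> bool" where
  "closed_tm L t \<longleftrightarrow> is_tm L t \<and> vars_tm t = {}"

fun fv :: "('f, 'p) fm \<Rightarrow> var set" where
  "fv (Eq t u) = vars_tm t \<union> vars_tm u"
| "fv (Rel P ts) = (\<Union>t \<in> set ts. vars_tm t)"
| "fv (And \<phi> \<psi>) = fv \<phi> \<union> fv \<psi>"
| "fv (Neg \<phi>) = fv \<phi>"
| "fv (Forall x \<phi>) = fv \<phi> - {x}"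
| "fv (Choice \<phi> \<psi>) = fv \<phi> \<union> fv \<psi>"

fun subst_tm :: "(var \<Rightarrow> 'f tm) \<Rightarrow> 'f tm \<Rightarrow> 'f tm" where
  "subst_tm \<theta> (Var x) = \<theta> x"
| "subst_tm \<theta> (Fn F ts) = Fn F (map (subst_tm \<theta>) ts)"

text \<open>
  Simultaneous substitution for the free occurrences of variables. Bound variables are never
  renamed: the terms substituted below are closed, so nothing can be captured.
\<close>

fun subst :: "(var \<Rightarrow> 'f tm) \<Rightarrow> ('f, 'p) fm \<Rightarrow> ('f, 'p) fm" where
  "subst \<theta> (Eq t u) = Eq (subst_tm \<theta> t) (subst_tm \<theta> u)"
| "subst \<theta> (Rel P ts) = Rel P (map (subst_tm \<theta>) ts)"
| "subst \<theta> (And \<phi> \<psi>) = And (subst \<theta> \<phi>) (subst \<theta> \<psi>)"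
| "subst \<theta> (Neg \<phi>) = Neg (subst \<theta> \<phi>)"
| "subst \<theta> (Forall x \<phi>) = Forall x (subst (\<theta>(x := Var x)) \<phi>)"
| "subst \<theta> (Choice \<phi> \<psi>) = Choice (subst \<theta> \<phi>) (subst \<theta> \<psi>)"

definition inst :: "('f, 'p) fm \<Rightarrow> var list \<Rightarrow> 'f tm list \<Rightarrow> ('f, 'p) fm" where
  "inst \<phi> vs ts = subst (\<lambda>x. case map_of (zip vs ts) x of None \<Rightarrow> Var x | Some t \<Rightarrow> t) \<phi>"

definition Foralls :: "var list \<Rightarrow> ('f, 'p) fm \<Rightarrow> ('f, 'p) fm" where
  "Foralls vs \<phi> = foldr Forall vs \<phi>"

record ('f, 'p, 'u) struct =
  univ :: "'u set"
  fun_interp :: "'f \<Rightarrow> 'u list \<Rightarrow> 'u"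
  rel_interp :: "'p \<Rightarrow> 'u list \<Rightarrow> bool"

definition is_struct :: "('f, 'p) language \<Rightarrow> ('f, 'p, 'u) struct \<Rightarrow> bool" where
  "is_struct L M \<longleftrightarrow> univ M \<noteq> {} \<and>
     (\<forall>F \<in> fun_syms L. \<forall>as. length as = fun_arity L F \<and> set as \<subseteq> univ M \<longrightarrow> fun_interp M F as \<in> univ M)"

fun eval_tm :: "('f, 'p, 'u) struct \<Rightarrow> (var \<Rightarrow> 'u) \<Rightarrow> 'f tm \<Rightarrow> 'u" where
  "eval_tm M e (Var x) = e x"
| "eval_tm M e (Fn F ts) = fun_interp M F (map (eval_tm M e) ts)"

text \<open>Satisfaction is defined for formulas of \<open>L\<close> only; it is left unspecified on \<open>Choice\<close>.\<close>

primrec (nonexhaustive) sat :: "('f, 'p, 'u) struct \<Rightarrow> (var \<Rightarrow> 'u) \<Rightarrow> ('f, 'p) fm \<Rightarrow> bool" where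
  "sat M e (Eq t u) = (eval_tm M e t = eval_tm M e u)"
| "sat M e (Rel P ts) = rel_interp M P (map (eval_tm M e) ts)"
| "sat M e (And \<phi> \<psi>) = (sat M e \<phi> \<and> sat M e \<psi>)"
| "sat M e (Neg \<phi>) = (\<not> sat M e \<phi>)"
| "sat M e (Forall x \<phi>) = (\<forall>a \<in> univ M. sat M (e(x := a)) \<phi>)"

definition models :: "('f, 'p, 'u) struct \<Rightarrow> ('f, 'p) fm \<Rightarrow> bool" where
  "models M \<phi> \<longleftrightarrow> (\<forall>e. range e \<subseteq> univ M \<longrightarrow> sat M e \<phi>)"

text \<open>
  HOL cannot quantify over all types inside a formula, so the universe is a nonempty subset of an
  explicitly given type \<open>'u\<close>, which remains arbitrary in every statement using this notion.
\<close>

definition satisfiable :: "'u itself \<Rightarrow> ('f, 'p) language \<Rightarrow> ('f, 'p) fm \<Rightarrow> bool" where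
  "satisfiable (_ :: 'u itself) L \<phi> \<longleftrightarrow> (\<exists>M :: ('f, 'p, 'u) struct. is_struct L M \<and> models M \<phi>)"

text \<open>
  The argument of \<open>f\<close> is the unordered pair \<open>{\<alpha>, \<beta>}\<close> itself; values on other sets play no role.
\<close>

definition choice_function :: "('f, 'p) language \<Rightarrow> (('f, 'p) fm set \<Rightarrow> ('f, 'p) fm) \<Rightarrow> bool" where
  "choice_function L f \<longleftrightarrow> (\<forall>\<alpha> \<in> Fml L. \<forall>\<beta> \<in> Fml L. f {\<alpha>, \<beta>} \<in> {\<alpha>, \<beta>})"

text \<open>
  The clause for formulas of \<open>L\<close> is stated here for atoms only; the other cases of it follow from
  the remaining clauses, see \<open>collapse_Fml\<close>.
\<close>

fun collapse :: "(('f, 'p) fm set \<Rightarrow> ('f, 'p) fm) \<Rightarrow> ('f, 'p) fm \<Rightarrow> ('f, 'p) fm" where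
  "collapse f (Eq t u) = Eq t u"
| "collapse f (Rel P ts) = Rel P ts"
| "collapse f (And \<phi> \<psi>) = And (collapse f \<phi>) (collapse f \<psi>)"
| "collapse f (Neg \<phi>) = Neg (collapse f \<phi>)"
| "collapse f (Forall x \<phi>) = Forall x (collapse f \<phi>)"
| "collapse f (Choice \<phi> \<psi>) = f {collapse f \<phi>, collapse f \<psi>}"

lemma collapse_Fml: "\<alpha> \<in> Fml L \<Longrightarrow> collapse f \<alpha> = \<alpha>"
  by (induction rule: Fml.induct) auto

lemma collapse_in_Fml:
  assumes "choice_function L f" "\<phi> \<in> Fml_s L"
  shows "collapse f \<phi> \<in> Fml L"
  using assms(2)
proof induction
  case (6 \<phi> \<psi>)
  then have "f {collapse f \<phi>, collapse f \<psi>} \<in> {collapse f \<phi>, collapse f \<psi>}"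
    using assms(1) by (simp add: choice_function_def)
  with 6 show ?case by auto
qed (auto intro: Fml.intros)

definition models_s1 ::
  "('f, 'p, 'u) struct \<Rightarrow> (('f, 'p) fm set \<Rightarrow> ('f, 'p) fm) \<Rightarrow> ('f, 'p) fm \<Rightarrow> bool" where
  "models_s1 M f \<phi> \<longleftrightarrow> models M (collapse f \<phi>)"

end

theory Submission
  imports Defs
begin

text \<open>
  Let \<open>\<gamma>\<close> be the formula that \<open>f\<close> chooses from \<open>{\<alpha>, \<beta>}\<close>. Then \<open>(\<alpha> | \<beta>) \<longrightarrow> \<gamma>\<close> collapses to the
  tautology \<open>\<gamma> \<longrightarrow> \<gamma>\<close>. The substitutions of \<open>ts\<close> and of \<open>ss\<close> turn \<open>{\<alpha>, \<beta>}\<close> into the same unordered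
  pair, on which \<open>f\<close> makes one choice, whereas they exchange the roles of \<open>\<alpha>\<close> and \<open>\<beta>\<close>. So for one
  of them the choice differs from the instance of \<open>\<gamma>\<close>, and there the implication fails in some
  structure.
\<close>

lemma is_tm_subst_tm: "is_tm L t \<Longrightarrow> (\<And>x. is_tm L (\<theta> x)) \<Longrightarrow> is_tm L (subst_tm \<theta> t)"
  by (induction t) auto

lemma subst_in_Fml: "\<phi> \<in> Fml L \<Longrightarrow> (\<And>x. is_tm L (\<theta> x)) \<Longrightarrow> subst \<theta> \<phi> \<in> Fml L"
  \<comment> \<open>\<open>\<theta>\<close> must vary, since passing under \<open>Forall x\<close>
    replaces it by \<open>\<theta>(x := Var x)\<close>.\<close>
  by (induction arbitrary: \<theta> rule: Fml.induct) (auto intro!: Fml.intros is_tm_subst_tm)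

lemma inst_in_Fml:
  assumes "\<phi> \<in> Fml L" "\<forall>t \<in> set ts. closed_tm L t"
  shows "inst \<phi> vs ts \<in> Fml L"
  unfolding inst_def
proof (rule subst_in_Fml[OF assms(1)])
  fix x
  show "is_tm L (case map_of (zip vs ts) x of None \<Rightarrow> Var x | Some t \<Rightarrow> t)"
    using assms(2)
    by (auto simp: closed_tm_def split: option.split dest!: map_of_SomeD set_zip_rightD)
qed

lemma collapse_Foralls: "collapse f (Foralls vs \<phi>) = Foralls vs (collapse f \<phi>)"
  by (induction vs) (auto simp: Foralls_def)

text \<open>Allowing all assignments in the premise, even those leaving \<open>univ M\<close>,
  spares the induction a range condition; a propositional tautology meets it.\<close>

lemma sat_Foralls: "(\<And>e. sat M e \<phi>) \<Longrightarrow> sat M e (Foralls vs \<phi>)"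
  by (induction vs arbitrary: e) (auto simp: Foralls_def)

text \<open>Substitution does not commute with collapsing: under the quantifiers \<open>f\<close>
  chooses from \<open>{\<alpha>, \<beta>}\<close> and returns \<open>\<gamma>\<close>, but in the
  instance it chooses afresh from the pair of instances. The first conjunct thus collapses to a
  closure of a tautology, the second to the double negation of the last premise.\<close>

lemma models_s1_valid_with_false_instance:
  assumes "\<alpha> \<in> Fml L" "\<beta> \<in> Fml L" "\<forall>r \<in> set rs. closed_tm L r"
    and "\<gamma> \<in> Fml L" "f {\<alpha>, \<beta>} = \<gamma>"
    and "models M (And (f {inst \<alpha> vs rs, inst \<beta> vs rs}) (Neg (inst \<gamma> vs rs)))"
  shows "models_s1 M f
    (And (Foralls vs (Neg (And (Choice \<alpha> \<beta>) (Neg \<gamma>))))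
         (Neg (inst (Neg (And (Choice \<alpha> \<beta>) (Neg \<gamma>))) vs rs)))"
proof -
  have "collapse f (inst \<phi> vs rs) = inst \<phi> vs rs" if "\<phi> \<in> Fml L" for \<phi>
    using collapse_Fml inst_in_Fml[OF that assms(3)] .
  then have "collapse f (inst (Neg (And (Choice \<alpha> \<beta>) (Neg \<gamma>))) vs rs)
      = Neg (And (f {inst \<alpha> vs rs, inst \<beta> vs rs}) (Neg (inst \<gamma> vs rs)))"
    using assms(1,2,4) by (simp add: inst_def)
  moreover have "collapse f (Neg (And (Choice \<alpha> \<beta>) (Neg \<gamma>))) = Neg (And \<gamma> (Neg \<gamma>))"
    using assms(1,2,4,5) by (simp add: collapse_Fml)
  ultimately show ?thesis
    using assms(6) by (simp add: models_s1_def models_def collapse_Foralls sat_Foralls)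
qed

theorem theorem3p5:
  fixes L :: "('f, 'p) language"
    and \<alpha> \<beta> :: "('f, 'p) fm"
    and vs :: "var list"
    and ts ss :: "'f tm list"
  assumes "\<alpha> \<in> Fml L" and "\<beta> \<in> Fml L"
    and "distinct vs" and "fv \<alpha> \<subseteq> set vs" and "fv \<beta> \<subseteq> set vs"
    and "length ts = length vs" and "\<forall>t \<in> set ts. closed_tm L t"
    and "length ss = length vs" and "\<forall>s \<in> set ss. closed_tm L s"
    and a: "inst \<alpha> vs ss = inst \<beta> vs ts"
    and b: "inst \<alpha> vs ts = inst \<beta> vs ss"
    and c1: "satisfiable TYPE('u) L (And (inst \<alpha> vs ts) (Neg (inst \<beta> vs ts)))"
    and c2: "satisfiable TYPE('u) L (And (Neg (inst \<alpha> vs ts)) (inst \<beta> vs ts))"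
  shows "\<forall>f. choice_function L f \<longrightarrow>
    (\<exists>(M :: ('f, 'p, 'u) struct) \<psi> rs.
       is_struct L M \<and>
       \<psi> \<in> Fml_s L \<and> fv \<psi> \<subseteq> set vs \<and>
       length rs = length vs \<and> (\<forall>r \<in> set rs. closed_tm L r) \<and>
       models_s1 M f (And (Foralls vs \<psi>) (Neg (inst \<psi> vs rs))))"
proof (intro allI impI)
  fix f assume f: "choice_function L f"
  let ?A = "inst \<alpha> vs ts" and ?B = "inst \<beta> vs ts"
  define \<gamma> where "\<gamma> = f {\<alpha>, \<beta>}"
  have \<gamma>: "\<gamma> = \<alpha> \<or> \<gamma> = \<beta>"
    using f assms(1,2) by (auto simp: choice_function_def \<gamma>_def)
  have "?A \<in> Fml L" "?B \<in> Fml L"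
    using assms inst_in_Fml by blast+
  then have fAB: "f {?A, ?B} = ?A \<or> f {?A, ?B} = ?B"
    using f by (auto simp: choice_function_def)
  have same_pair: "{inst \<alpha> vs ss, inst \<beta> vs ss} = {?A, ?B}"
    using a b by auto
  obtain M1 M2 :: "('f, 'p, 'u) struct" where
    M1: "is_struct L M1" "models M1 (And ?A (Neg ?B))" and
    M2: "is_struct L M2" "models M2 (And (Neg ?A) ?B)"
    using c1 c2 by (auto simp: satisfiable_def)
  from M2(2) have M2': "models M2 (And ?B (Neg ?A))"
    by (auto simp: models_def)
  have "\<exists>(M :: ('f, 'p, 'u) struct) rs. is_struct L M \<and> rs \<in> {ts, ss} \<and>
      models M (And (f {inst \<alpha> vs rs, inst \<beta> vs rs}) (Neg (inst \<gamma> vs rs)))"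
  proof (cases "f {?A, ?B} = inst \<gamma> vs ts")
    \<comment> \<open>Take \<open>rs = ss\<close>: the choice from the pair is still
      \<open>inst \<gamma> vs ts\<close>, while \<open>inst \<gamma> vs ss\<close> is now the other
      member. \<open>M1\<close> serves if \<open>\<gamma> = \<alpha>\<close>, \<open>M2\<close> if
      \<open>\<gamma> = \<beta>\<close>.\<close>
    case True
    then show ?thesis
      using \<gamma> M1 M2(1) M2' by (metis same_pair a b insertCI)
  next
    \<comment> \<open>Take \<open>rs = ts\<close>: \<open>f\<close> picks the member other than
      \<open>inst \<gamma> vs ts\<close>, so the models swap roles: \<open>M2\<close> for
      \<open>\<alpha>\<close>, \<open>M1\<close> for \<open>\<beta>\<close>.\<close>
    case False
    then show ?thesis
      using \<gamma> fAB M1 M2(1) M2' by (metis insertCI)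
  qed
  then obtain M :: "('f, 'p, 'u) struct" and rs where M: "is_struct L M" "rs \<in> {ts, ss}"
      "models M (And (f {inst \<alpha> vs rs, inst \<beta> vs rs}) (Neg (inst \<gamma> vs rs)))"
    by blast
  from M(2) have rs: "length rs = length vs" "\<forall>r \<in> set rs. closed_tm L r"
    using assms by auto
  \<comment> \<open>The implication from \<open>Choice \<alpha> \<beta>\<close> to
    \<open>\<gamma>\<close> in primitive connectives.\<close>
  let ?\<psi> = "Neg (And (Choice \<alpha> \<beta>) (Neg \<gamma>))"
  have \<gamma>_Fml: "\<gamma> \<in> Fml L"
    using \<gamma> assms by auto
  then have "?\<psi> \<in> Fml_s L"
    using assms(1,2) Fml_subset_Fml_s by (blast intro: Fml_s.intros)
  moreover have "fv ?\<psi> \<subseteq> set vs"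
    using \<gamma> assms by auto
  moreover have "models_s1 M f (And (Foralls vs ?\<psi>) (Neg (inst ?\<psi> vs rs)))"
    using models_s1_valid_with_false_instance[OF assms(1,2) rs(2) \<gamma>_Fml \<gamma>_def[symmetric] M(3)] .
  ultimately show "\<exists>(M :: ('f, 'p, 'u) struct) \<psi> rs.
       is_struct L M \<and>
       \<psi> \<in> Fml_s L \<and> fv \<psi> \<subseteq> set vs \<and>
       length rs = length vs \<and> (\<forall>r \<in> set rs. closed_tm L r) \<and>
       models_s1 M f (And (Foralls vs \<psi>) (Neg (inst \<psi> vs rs)))"
    using M(1) rs by blast
qed

end
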